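(* Let $(V,\Omega)$ be a real symplectic vector space of dimension $2n$ endowed with a positive compatible complex structure $j$. Let $\mathcal{N}(V,\Omega,j)$ be the real vector space of bilinear maps $T:V\times V\to V$ satisfying, for all $X,Y,Z\in V$, $$T(X,Y)=-T(Y,X),\qquad T(jX,Y)=-jT(X,Y),$$ $$\Omega(T(X,Y),Z)+\Omega(T(Y,Z),X)+\Omega(T(Z,X),Y)=0.$$ Then $\mathcal{N}(V,\Omega,j)$ is irreducible under the action of the unitary group $Sp(V,\Omega)\cap Gl(V,j)$.
   Context: A complex structure $j$ on $V$ is a linear map $j:V\to V$ with $j^2=-\mathrm{Id}$. It is compatible with $\Omega$ if the bilinear form $(X,Y)\mapsto \Omega(X,jY)$ is symmetric, and positive if moreover this form is positive definite. $Sp(V,\Omega)$ is the group of linear automorphisms of $V$ preserving $\Omega$, and $Gl(V,j)$ is the group of linear automorphisms of $V$ commuting with $j$. A group element $g$ acts on $T$ by $(g\cdot T)(X,Y)=g\,T(g^{-1}X,g^{-1}Y)$. Irreducible means that the only real linear subspaces invariant under the action are $\{0\}$ and the whole space. *)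

theory Defs
  imports "HOL-Analysis.Analysis" "HOL-Library.Function_Algebras"
begin

text \<open>Pointwise scalar multiplication, so that the maps \<open>V \<Rightarrow> V \<Rightarrow> V\<close> form a real vector space and
  \<^const>\<open>subspace\<close> applies to sets of such maps.\<close>

instantiation "fun" :: (type, real_vector) real_vector
begin

definition scaleR_fun :: "real \<Rightarrow> ('a \<Rightarrow> 'b) \<Rightarrow> 'a \<Rightarrow> 'b"
  where "scaleR_fun c f = (\<lambda>x. c *\<^sub>R f x)"

instance
  by standard (auto simp: scaleR_fun_def plus_fun_def fun_eq_iff algebra_simps)

end

definition symplectic_form :: "('v::real_vector \<Rightarrow> 'v \<Rightarrow> real) \<Rightarrow> bool"
  where "symplectic_form \<Omega> \<longleftrightarrow>
    bilinear \<Omega> \<and> (\<forall>X Y. \<Omega> X Y = - \<Omega> Y X) \<and> (\<forall>X. (\<forall>Y. \<Omega> X Y = 0) \<longrightarrow> X = 0)"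

definition complex_structure :: "('v::real_vector \<Rightarrow> 'v) \<Rightarrow> bool"
  where "complex_structure j \<longleftrightarrow> linear j \<and> (\<forall>X. j (j X) = - X)"

definition compatible_complex_structure ::
    "('v::real_vector \<Rightarrow> 'v \<Rightarrow> real) \<Rightarrow> ('v \<Rightarrow> 'v) \<Rightarrow> bool"
  where "compatible_complex_structure \<Omega> j \<longleftrightarrow>
    complex_structure j \<and> (\<forall>X Y. \<Omega> X (j Y) = \<Omega> Y (j X))"

definition positive_compatible_complex_structure ::
    "('v::real_vector \<Rightarrow> 'v \<Rightarrow> real) \<Rightarrow> ('v \<Rightarrow> 'v) \<Rightarrow> bool"
  where "positive_compatible_complex_structure \<Omega> j \<longleftrightarrow>
    compatible_complex_structure \<Omega> j \<and> (\<forall>X. X \<noteq> 0 \<longrightarrow> 0 < \<Omega> X (j X))"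

definition Sp :: "('v::real_vector \<Rightarrow> 'v \<Rightarrow> real) \<Rightarrow> ('v \<Rightarrow> 'v) set"
  where "Sp \<Omega> = {g. linear g \<and> bij g \<and> (\<forall>X Y. \<Omega> (g X) (g Y) = \<Omega> X Y)}"

definition Gl :: "('v::real_vector \<Rightarrow> 'v) \<Rightarrow> ('v \<Rightarrow> 'v) set"
  where "Gl j = {g. linear g \<and> bij g \<and> (\<forall>X. g (j X) = j (g X))}"

definition tensor_action :: "('v \<Rightarrow> 'v) \<Rightarrow> ('v \<Rightarrow> 'v \<Rightarrow> 'v) \<Rightarrow> 'v \<Rightarrow> 'v \<Rightarrow> 'v"
  where "tensor_action g T = (\<lambda>X Y. g (T (inv g X) (inv g Y)))"

definition \<N> :: "('v::real_vector \<Rightarrow> 'v \<Rightarrow> real) \<Rightarrow> ('v \<Rightarrow> 'v) \<Rightarrow> ('v \<Rightarrow> 'v \<Rightarrow> 'v) set"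
  where "\<N> \<Omega> j = {T. bilinear T
    \<and> (\<forall>X Y. T X Y = - T Y X)
    \<and> (\<forall>X Y. T (j X) Y = - j (T X Y))
    \<and> (\<forall>X Y Z. \<Omega> (T X Y) Z + \<Omega> (T Y Z) X + \<Omega> (T Z X) Y = 0)}"

definition invariant_subspace :: "'g set \<Rightarrow> ('g \<Rightarrow> 'b::real_vector \<Rightarrow> 'b) \<Rightarrow> 'b set \<Rightarrow> bool"
  where "invariant_subspace G act W \<longleftrightarrow> subspace W \<and> (\<forall>g\<in>G. \<forall>T\<in>W. act g T \<in> W)"

text \<open>The space \<open>N\<close> itself must be an invariant subspace, so that \<open>G\<close> really acts on it. The zero
  space counts as irreducible.\<close>

definition irreducible_under :: "'g set \<Rightarrow> ('g \<Rightarrow> 'b::real_vector \<Rightarrow> 'b) \<Rightarrow> 'b set \<Rightarrow> bool"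
  where "irreducible_under G act N \<longleftrightarrow> invariant_subspace G act N
    \<and> (\<forall>W. W \<subseteq> N \<and> invariant_subspace G act W \<longrightarrow> W = {0} \<or> W = N)"

end

theory Submission
  imports Defs
begin

text \<open>
  With the Hermitian form \<open>h(X,Y) = \<Omega>(X,jY) - i \<Omega>(X,Y)\<close>, a tensor \<open>T\<close> is antilinear in both arguments, and
  \<open>\<Omega>(T(X,Y),Z)\<close> is the imaginary part of a complex trilinear form of mixed symmetry; the group
  element \<open>j\<close> acts on \<open>T\<close> as \<open>-j\<close>, so an invariant subspace \<open>W\<close> is a complex subspace.
  If \<open>T \<in> W\<close> is nonzero, polarization yields orthonormal \<open>u, v\<close> with \<open>h(T(u,v),u) \<noteq> 0\<close>. Unitary maps
  that rotate only the line of \<open>u\<close>, or only that of \<open>v\<close>, isolate the weight component of \<open>T\<close> of degree 2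
  in \<open>u\<close> and 1 in \<open>v\<close>, a nonzero multiple of \<open>(u \<and> v) \<otimes> u\<close>. Complex Householder reflections carry it to
  every other orthonormal pair. Polarizing again, modulo \<open>W\<close>, gives all Young symmetrized tensors, and
  each element of the space is a sum of these by expansion in a unitary frame.
\<close>

text \<open>Modulo \<open>W\<close>, expanding \<open>f (x + z) y (x + z)\<close> makes
  \<open>f\<close> alternating in its outer arguments, hence totally alternating. The three cyclic
  terms then agree modulo \<open>W\<close>, so \<open>3 f\<close> lies in \<open>W\<close>. Working
  modulo a subspace serves both the zero space and an invariant subspace.\<close>

lemma mem_of_polarization:
  fixes f :: "'v::ab_group_add \<Rightarrow> 'v \<Rightarrow> 'v \<Rightarrow> 'b::real_vector"
  assumes W: "subspace W"
    and add1: "\<And>x x' y z. f (x + x') y z = f x y z + f x' y z"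
    and add3: "\<And>x y z z'. f x y (z + z') = f x y z + f x y z'"
    and alt: "\<And>x y z. f x y z = - f y x z"
    and cyc: "\<And>x y z. f x y z + f y z x + f z x y = 0"
    and diag: "\<And>x y. f x y x \<in> W"
  shows "f x y z \<in> W"
proof -
  have swap: "f x y z + f z y x \<in> W" for x y z
  proof -
    have "f x y z + f z y x = f (x + z) y (x + z) - f x y x - f z y z"
      by (simp add: add1 add3 algebra_simps)
    then show ?thesis using W diag by (simp add: subspace_diff)
  qed
  have "3 *\<^sub>R f x y z = (f x y z + f z y x) - (f y x z + f z x y)"
  proof -
    have e1: "f z y x = - f y z x" and e2: "f y x z = - f x y z" by (metis alt)+
    have e3: "f y z x = - f x y z - f z x y"
      using cyc[of x y z] by (simp add: add_eq_0_iff algebra_simps)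
    show ?thesis unfolding e1 e2 unfolding e3 by (simp add: algebra_simps scaleR_left_distrib[of 1 2, simplified] scaleR_2)
  qed
  then have "(1/3) *\<^sub>R (3 *\<^sub>R f x y z) \<in> W"
    using swap[of x y z] swap[of y x z] W by (simp add: subspace_add subspace_diff subspace_scale)
  then show ?thesis by simp
qed

section \<open>Complex scalars and the Hermitian form\<close>

locale hermitian_space =
  fixes \<Omega> :: "'v::real_vector \<Rightarrow> 'v \<Rightarrow> real" and j :: "'v \<Rightarrow> 'v"
  assumes symplectic: "symplectic_form \<Omega>"
    and positive: "positive_compatible_complex_structure \<Omega> j"
begin

lemma j_linear: "linear j" and j_j [simp]: "j (j X) = - X"
  using positive
  by (auto simp: positive_compatible_complex_structure_def compatible_complex_structure_def
      complex_structure_def)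

lemmas j_simps [simp] = linear_add[OF j_linear] linear_diff[OF j_linear] linear_scale[OF j_linear]
  linear_neg[OF j_linear] linear_0[OF j_linear]

lemma \<Omega>_bilinear: "bilinear \<Omega>" and \<Omega>_alt: "\<Omega> X Y = - \<Omega> Y X"
  using symplectic unfolding symplectic_form_def by blast+

lemmas \<Omega>_simps [simp] =
  bilinear_ladd[OF \<Omega>_bilinear] bilinear_radd[OF \<Omega>_bilinear]
  bilinear_lsub[OF \<Omega>_bilinear] bilinear_rsub[OF \<Omega>_bilinear]
  bilinear_lmul[OF \<Omega>_bilinear] bilinear_rmul[OF \<Omega>_bilinear]
  bilinear_lneg[OF \<Omega>_bilinear] bilinear_rneg[OF \<Omega>_bilinear]
  bilinear_lzero[OF \<Omega>_bilinear] bilinear_rzero[OF \<Omega>_bilinear]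

lemma \<Omega>_self [simp]: "\<Omega> X X = 0"
  using \<Omega>_alt[of X X] by linarith

lemma \<Omega>_compat: "\<Omega> X (j Y) = \<Omega> Y (j X)"
  and \<Omega>_pos: "X \<noteq> 0 \<Longrightarrow> 0 < \<Omega> X (j X)"
  using positive
  by (auto simp: positive_compatible_complex_structure_def compatible_complex_structure_def)

lemma \<Omega>_j_left: "\<Omega> (j X) Y = - \<Omega> X (j Y)"
  using \<Omega>_alt[of "j X" Y] \<Omega>_compat[of Y X] by simp

lemma \<Omega>_ext:
  assumes "\<And>Z. \<Omega> X Z = \<Omega> Y Z"
  shows "X = Y"
proof -
  have "\<Omega> (X - Y) Z = 0" for Z using assms by simp
  then show ?thesis using symplectic unfolding symplectic_form_def by (metis eq_iff_diff_eq_0)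
qed

definition cscale :: "complex \<Rightarrow> 'v \<Rightarrow> 'v"  (infixr "\<odot>" 75)
  where "c \<odot> X = Re c *\<^sub>R X + Im c *\<^sub>R j X"

text \<open>The sign of the imaginary part makes the form complex linear in the first argument and
  antilinear in the second.\<close>

definition herm :: "'v \<Rightarrow> 'v \<Rightarrow> complex"
  where "herm X Y = Complex (\<Omega> X (j Y)) (- \<Omega> X Y)"

sublocale cx: vector_space "(\<odot>)"
  by standard (auto simp: cscale_def algebra_simps)

lemma \<Omega>_eq_Im_herm: "\<Omega> X Y = - Im (herm X Y)"
  by (simp add: herm_def)

lemma herm_simps [simp]:
  "herm (X + X') Y = herm X Y + herm X' Y" "herm Y (X + X') = herm Y X + herm Y X'"
  "herm (X - X') Y = herm X Y - herm X' Y" "herm Y (X - X') = herm Y X - herm Y X'"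
  "herm (c \<odot> X) Y = c * herm X Y" "herm Y (c \<odot> X) = cnj c * herm Y X"
  "herm (- X) Y = - herm X Y" "herm 0 Y = 0" "herm Y 0 = 0"
  by (auto simp: herm_def complex_eq_iff cscale_def \<Omega>_j_left algebra_simps)

lemma cnj_herm [simp]: "cnj (herm X Y) = herm Y X"
  using \<Omega>_compat[of X Y] \<Omega>_alt[of X Y] by (simp add: herm_def complex_eq_iff)

lemma herm_eq_0_iff [simp]: "herm X X = 0 \<longleftrightarrow> X = 0"
  using \<Omega>_pos[of X] by (cases "X = 0") (auto simp: herm_def complex_eq_iff)

lemma herm_self: "herm X X = of_real (Re (herm X X))" "X \<noteq> 0 \<Longrightarrow> Re (herm X X) > 0"
  using \<Omega>_pos[of X] by (auto simp: herm_def complex_eq_iff)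

lemma herm_sum_left: "herm (sum f B) Y = (\<Sum>b\<in>B. herm (f b) Y)"
  by (induction B rule: infinite_finite_induct) auto

lemma herm_sum_right: "herm Y (sum f B) = (\<Sum>b\<in>B. herm Y (f b))"
  by (induction B rule: infinite_finite_induct) auto

lemma cscale_of_real: "of_real a \<odot> X = a *\<^sub>R X"
  by (simp add: cscale_def)

lemma j_cscale: "j (c \<odot> X) = (\<i> * c) \<odot> X"
  by (simp add: cscale_def)

lemma herm_j: "herm (j X) Y = \<i> * herm X Y"
  using herm_simps(5)[of \<i> X Y] by (simp add: cscale_def)

section \<open>Orthonormal frames\<close>

lemma normalize:
  assumes "X \<noteq> 0"
  obtains a :: complex and x where "herm x x = 1" "X = a \<odot> x" "a \<noteq> 0"
proof -
  define a :: complex where "a = of_real (sqrt (Re (herm X X)))"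
  have a: "a * a = herm X X" "a \<noteq> 0" "cnj a = a"
    using herm_self[of X] assms by (auto simp: a_def simp flip: of_real_mult)
  show thesis
  proof
    show "herm (inverse a \<odot> X) (inverse a \<odot> X) = 1"
      using a by (simp add: field_simps flip: a(1))
    show "X = a \<odot> (inverse a \<odot> X)" using a by simp
  qed (use a in auto)
qed

text \<open>Complex Gram-Schmidt: the residue of the new vector is orthogonal to the frame and, if
  nonzero, is normalized and added. Vectors already expanded in the old frame are orthogonal to the
  addition, so their expansions survive.\<close>

lemma orthonormal_frame:
  assumes "finite A"
  shows "\<exists>B. finite B \<and> (\<forall>a\<in>B. \<forall>b\<in>B. herm a b = (if a = b then 1 else 0)) \<and>
    (\<forall>X\<in>A. X = (\<Sum>b\<in>B. herm X b \<odot> b))"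
  using assms
proof (induction A)
  case empty
  then show ?case by (intro exI[of _ "{}"]) auto
next
  case (insert X A)
  then obtain B where B: "finite B" "\<And>a b. a \<in> B \<Longrightarrow> b \<in> B \<Longrightarrow> herm a b = (if a = b then 1 else 0)"
    "\<And>X. X \<in> A \<Longrightarrow> X = (\<Sum>b\<in>B. herm X b \<odot> b)" by metis
  define r where "r = X - (\<Sum>b\<in>B. herm X b \<odot> b)"
  have r: "herm r b = 0" if "b \<in> B" for b
  proof -
    have "herm r b = herm X b - (\<Sum>a\<in>B. if a = b then herm X a else 0)"
      unfolding r_def herm_simps herm_sum_left
      by (intro arg_cong2[where f="(-)"] sum.cong) (auto simp: B(2) that)
    then show ?thesis using B(1) that by simp
  qed
  show ?case
  proof (cases "r = 0")
    case True
    then have "X = (\<Sum>b\<in>B. herm X b \<odot> b)" by (simp only: r_def right_minus_eq)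
    then show ?thesis using B by blast
  next
    case False
    obtain c e where e: "herm e e = 1" "r = c \<odot> e" "c \<noteq> 0"
      by (rule normalize[OF False])
    have eb: "herm e b = 0" "herm b e = 0" if "b \<in> B" for b
    proof -
      show 0: "herm e b = 0" using r[OF that] e by simp
      show "herm b e = 0" using cnj_herm[of e b] unfolding 0 by simp
    qed
    have "e \<notin> B" using e(1) eb by force
    have A: "herm Y e = 0" if "Y \<in> A" for Y
    proof -
      have "herm Y e = (\<Sum>b\<in>B. herm Y b * herm b e)"
        by (subst B(3)[OF that]) (simp add: herm_sum_left)
      then show ?thesis by (simp add: eb)
    qed
    have Xe: "herm X e = c"
    proof -
      have "herm X e = herm r e + (\<Sum>b\<in>B. herm X b * herm b e)"
        unfolding r_def by (simp add: herm_sum_left)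
      then show ?thesis using e by (simp add: eb)
    qed
    have "X = (\<Sum>b\<in>insert e B. herm X b \<odot> b)"
      using \<open>e \<notin> B\<close> B(1) Xe e(2) r_def by (simp add: algebra_simps)
    moreover have "Y = (\<Sum>b\<in>insert e B. herm Y b \<odot> b)" if "Y \<in> A" for Y
      using \<open>e \<notin> B\<close> B(1) A[OF that] trans[OF B(3)[OF that], of "\<Sum>b\<in>insert e B. herm Y b \<odot> b"]
      by simp
    moreover have "herm a b = (if a = b then 1 else 0)" if "a \<in> insert e B" "b \<in> insert e B" for a b
      using that B(2) e(1) eb \<open>e \<notin> B\<close> by (cases "a = e"; cases "b = e") auto
    ultimately show ?thesis
      using B(1) by (intro exI[of _ "insert e B"]) blast
  qed
qed

lemma ex_frame:
  assumes "finite A" "span A = (UNIV :: 'v set)"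
  obtains B where "finite B" "\<And>X. X = (\<Sum>b\<in>B. herm X b \<odot> b)"
proof -
  obtain B where B: "finite B" "\<forall>X\<in>A. X = (\<Sum>b\<in>B. herm X b \<odot> b)"
    using orthonormal_frame[OF assms(1)] by metis
  have "X = (\<Sum>b\<in>B. herm X b \<odot> b)" if "X \<in> span A" for X
    using that
  proof (induction rule: span_induct_alt)
    case base
    show ?case by simp
  next
    case (step c x y)
    have "c *\<^sub>R x + y = of_real c \<odot> (\<Sum>b\<in>B. herm x b \<odot> b) + (\<Sum>b\<in>B. herm y b \<odot> b)"
      unfolding cscale_of_real using step B(2) by metis
    also have "\<dots> = (\<Sum>b\<in>B. herm (c *\<^sub>R x + y) b \<odot> b)"
      by (simp add: cx.scale_sum_right sum.distrib cx.scale_left_distrib flip: cscale_of_real)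
    finally show ?case .
  qed
  then show thesis using that[of B] B(1) assms(2) by simp
qed

section \<open>Complex reflections and the unitary action of \<open>j\<close>\<close>

text \<open>A unitary complex reflection exactly when \<open>c + cnj c = |c|\<^sup>2 h(w,w)\<close>, with inverse \<open>crefl w (cnj c)\<close>.
  For a unit vector \<open>u\<close> and \<open>|z| = 1\<close>, \<open>crefl u (1 - z)\<close> multiplies the line of \<open>u\<close> by \<open>z\<close>.\<close>

definition crefl :: "'v \<Rightarrow> complex \<Rightarrow> 'v \<Rightarrow> 'v"
  where "crefl w c X = X - (c * herm X w) \<odot> w"

lemma crefl_comp:
  assumes "c + d = c * d * herm w w"
  shows "crefl w c (crefl w d X) = X"
proof -
  have "crefl w c (crefl w d X) = X - ((c + d - c * d * herm w w) * herm X w) \<odot> w"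
    by (simp add: crefl_def algebra_simps)
  then show ?thesis using assms by simp
qed

context
  fixes w :: 'v and c :: complex
  assumes unimodular: "c + cnj c = c * cnj c * herm w w"
begin

lemma inv_crefl: "inv (crefl w c) = crefl w (cnj c)"
  using unimodular by (intro inv_equality crefl_comp) (auto simp: algebra_simps)

lemma herm_crefl: "herm (crefl w c X) (crefl w c Y) = herm X Y"
proof -
  have "herm (crefl w c X) (crefl w c Y)
      = herm X Y + (c * cnj c * herm w w - (c + cnj c)) * herm X w * herm w Y"
    by (simp add: crefl_def algebra_simps)
  then show ?thesis using unimodular by simp
qed

lemma crefl_unitary: "crefl w c \<in> Sp \<Omega> \<inter> Gl j"
proof -
  have "linear (crefl w c)"
    by (rule linearI) (simp_all add: crefl_def algebra_simps flip: cscale_of_real)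
  moreover have "bij (crefl w c)"
    using unimodular
    by (intro o_bij[where g = "crefl w (cnj c)"] ext)
      (auto intro!: crefl_comp simp: algebra_simps)
  moreover have "\<Omega> (crefl w c X) (crefl w c Y) = \<Omega> X Y" for X Y
    by (simp add: \<Omega>_eq_Im_herm herm_crefl)
  moreover have "crefl w c (j X) = j (crefl w c X)" for X
    by (simp add: crefl_def j_cscale herm_j mult.left_commute)
  ultimately show ?thesis by (simp add: Sp_def Gl_def)
qed

end

lemma j_unitary: "j \<in> Sp \<Omega> \<inter> Gl j" and inv_j: "inv j X = - j X"
proof -
  have "bij j" by (rule o_bij[where g = "\<lambda>X. - j X"]) auto
  moreover have "\<Omega> (j X) (j Y) = \<Omega> X Y" for X Y by (simp add: \<Omega>_j_left)
  ultimately show "j \<in> Sp \<Omega> \<inter> Gl j" by (simp add: Sp_def Gl_def j_linear)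
  have "inv j = (\<lambda>X. - j X)" by (rule inv_equality) auto
  then show "inv j X = - j X" by simp
qed

section \<open>The tensor space and its invariance\<close>

lemma \<N>_simps:
  assumes "T \<in> \<N> \<Omega> j"
  shows "T (X + X') Y = T X Y + T X' Y" "T X (Y + Y') = T X Y + T X Y'"
    "T (X - X') Y = T X Y - T X' Y" "T X (Y - Y') = T X Y - T X Y'"
    "T (c \<odot> X) Y = cnj c \<odot> T X Y" "T X (c \<odot> Y) = cnj c \<odot> T X Y"
    "T (a *\<^sub>R X) Y = a *\<^sub>R T X Y" "T (j X) Y = - j (T X Y)" "T X (j Y) = - j (T X Y)"
    "T (- X) Y = - T X Y" "T X (- Y) = - T X Y"
    "T 0 Y = 0" "T X 0 = 0" "T X X = 0"
proof -
  have T: "bilinear T" "\<And>X Y. T X Y = - T Y X" "\<And>X Y. T (j X) Y = - j (T X Y)"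
    using assms unfolding \<N>_def by blast+
  note [simp] = bilinear_ladd[OF T(1)] bilinear_radd[OF T(1)] bilinear_lsub[OF T(1)]
    bilinear_rsub[OF T(1)] bilinear_lmul[OF T(1)] bilinear_rmul[OF T(1)]
    bilinear_lneg[OF T(1)] bilinear_rneg[OF T(1)] bilinear_lzero[OF T(1)] bilinear_rzero[OF T(1)]
  have T4: "T X (j Y) = - j (T X Y)" for X Y
    using T(2)[of X "j Y"] T(2)[of X Y] T(3)[of Y X] by simp
  have "T X X + T X X = 0" using T(2)[of X X] by (metis add.right_inverse)
  then have "2 *\<^sub>R T X X = 0" by (simp add: scaleR_2)
  then show "T X X = 0" by simp
  show "T (X + X') Y = T X Y + T X' Y" "T X (Y + Y') = T X Y + T X Y'"
    "T (X - X') Y = T X Y - T X' Y" "T X (Y - Y') = T X Y - T X Y'"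
    "T (c \<odot> X) Y = cnj c \<odot> T X Y" "T X (c \<odot> Y) = cnj c \<odot> T X Y"
    "T (a *\<^sub>R X) Y = a *\<^sub>R T X Y" "T (j X) Y = - j (T X Y)" "T X (j Y) = - j (T X Y)"
    "T (- X) Y = - T X Y" "T X (- Y) = - T X Y" "T 0 Y = 0" "T X 0 = 0"
    by (simp_all add: cscale_def T(3) T4)
qed

lemma \<N>_alt: "T \<in> \<N> \<Omega> j \<Longrightarrow> T X Y = - T Y X"
  and \<N>_cyclic: "T \<in> \<N> \<Omega> j \<Longrightarrow> \<Omega> (T X Y) Z + \<Omega> (T Y Z) X + \<Omega> (T Z X) Y = 0"
  unfolding \<N>_def by blast+

lemma \<N>_sum:
  assumes "T \<in> \<N> \<Omega> j"
  shows "T (sum f A) Y = (\<Sum>a\<in>A. T (f a) Y)" "T X (sum f A) = (\<Sum>a\<in>A. T X (f a))"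
  by (induction A rule: infinite_finite_induct) (auto simp: \<N>_simps[OF assms])

lemma \<N>_I:
  assumes "\<And>X X' Y. T (X + X') Y = T X Y + T X' Y" "\<And>c X Y. T (c *\<^sub>R X) Y = c *\<^sub>R T X Y"
    and alt: "\<And>X Y. T X Y = - T Y X" and "\<And>X Y. T (j X) Y = - j (T X Y)"
    and "\<And>X Y Z. \<Omega> (T X Y) Z + \<Omega> (T Y Z) X + \<Omega> (T Z X) Y = 0"
  shows "T \<in> \<N> \<Omega> j"
proof -
  have "linear (\<lambda>X. T X Y)" for Y
    by (rule linearI) (simp_all add: assms(1,2))
  moreover have "linear (T Y)" for Y
  proof (rule linearI)
    show "T Y (X + X') = T Y X + T Y X'" for X X'
      unfolding alt[of Y] by (simp add: assms(1))
    show "T Y (c *\<^sub>R X) = c *\<^sub>R T Y X" for c X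
      unfolding alt[of Y] by (simp add: assms(2))
  qed
  ultimately have "bilinear T" by (simp add: bilinear_def)
  then show ?thesis using assms unfolding \<N>_def by blast
qed

lemma \<N>_invariant: "invariant_subspace (Sp \<Omega> \<inter> Gl j) tensor_action (\<N> \<Omega> j)"
  unfolding invariant_subspace_def
proof (intro conjI ballI)
  show "subspace (\<N> \<Omega> j)"
  proof (rule subspaceI)
    show "0 \<in> \<N> \<Omega> j"
      by (rule \<N>_I) simp_all
  next
    fix S T assume S: "S \<in> \<N> \<Omega> j" and T: "T \<in> \<N> \<Omega> j"
    show "S + T \<in> \<N> \<Omega> j"
    proof (rule \<N>_I)
      fix X Y Z
      show "(S + T) X Y = - (S + T) Y X"
        using \<N>_alt[OF S, of X Y] \<N>_alt[OF T, of X Y] by simp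
      show "\<Omega> ((S + T) X Y) Z + \<Omega> ((S + T) Y Z) X + \<Omega> ((S + T) Z X) Y = 0"
        using \<N>_cyclic[OF S, of X Y Z] \<N>_cyclic[OF T, of X Y Z] by simp
    qed (simp_all add: \<N>_simps[OF S] \<N>_simps[OF T] algebra_simps)
  next
    fix c T assume T: "T \<in> \<N> \<Omega> j"
    show "c *\<^sub>R T \<in> \<N> \<Omega> j"
    proof (rule \<N>_I)
      fix X Y Z
      show "(c *\<^sub>R T) X Y = - (c *\<^sub>R T) Y X"
        using \<N>_alt[OF T, of X Y] by (simp add: scaleR_fun_def)
      show "\<Omega> ((c *\<^sub>R T) X Y) Z + \<Omega> ((c *\<^sub>R T) Y Z) X + \<Omega> ((c *\<^sub>R T) Z X) Y = 0"
        using \<N>_cyclic[OF T, of X Y Z] by (simp add: scaleR_fun_def flip: distrib_left)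
    qed (simp_all add: scaleR_fun_def \<N>_simps[OF T] algebra_simps)
  qed
next
  fix g T assume g: "g \<in> Sp \<Omega> \<inter> Gl j" and T: "T \<in> \<N> \<Omega> j"
  have g': "linear g" "bij g" "\<And>X Y. \<Omega> (g X) (g Y) = \<Omega> X Y" "\<And>X. g (j X) = j (g X)"
    using g by (auto simp: Sp_def Gl_def)
  have gi [simp]: "g (inv g X) = X" for X using g'(2) by (simp add: bij_is_surj surj_f_inv_f)
  have inj: "g X = g Y \<Longrightarrow> X = Y" for X Y using g'(2) by (meson bij_is_inj injD)
  note [simp] = linear_add[OF g'(1)] linear_scale[OF g'(1)] linear_neg[OF g'(1)]
  have [simp]: "inv g (X + Y) = inv g X + inv g Y" "inv g (c *\<^sub>R X) = c *\<^sub>R inv g X"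
    "inv g (j X) = j (inv g X)" for X Y c
    by (rule inj, simp add: g'(4))+
  \<comment> \<open>The \<Omega>-adjoint of \<open>g\<close> is its inverse. This turns the cyclic
    identity for the transformed tensor into that of \<open>T\<close> at the preimages.\<close>
  have \<Omega>g: "\<Omega> (g X) Y = \<Omega> X (inv g Y)" for X Y
    using g'(3)[of X "inv g Y"] by simp
  have T': "bilinear T" "\<And>X Y. T X Y = - T Y X" "\<And>X Y. T (j X) Y = - j (T X Y)"
    "\<And>X Y Z. \<Omega> (T X Y) Z + \<Omega> (T Y Z) X + \<Omega> (T Z X) Y = 0"
    using T unfolding \<N>_def by blast+
  show "tensor_action g T \<in> \<N> \<Omega> j"
    unfolding tensor_action_def
  proof (rule \<N>_I)
    show "g (T (inv g X) (inv g Y)) = - g (T (inv g Y) (inv g X))" for X Y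
      using T'(2)[of "inv g X" "inv g Y"] by simp
  qed (simp_all add: T'(3,4) g'(4) \<Omega>g bilinear_ladd[OF T'(1)] bilinear_lmul[OF T'(1)])
qed

section \<open>Young symmetrized tensors\<close>

text \<open>The tensor (p \<and> q) \<otimes> r. The conjugate makes it antilinear in
  \<open>X\<close> and \<open>Y\<close>, and complex linear in \<open>p\<close>, \<open>q\<close>,
  \<open>r\<close>.\<close>

definition wedge :: "'v \<Rightarrow> 'v \<Rightarrow> 'v \<Rightarrow> 'v \<Rightarrow> 'v \<Rightarrow> 'v"
  where "wedge p q r X Y = cnj (herm X p * herm Y q - herm X q * herm Y p) \<odot> r"

text \<open>Three times \<open>wedge p q r\<close> minus its cyclic sum: up to a factor, the
  projection that removes the totally alternating part.\<close>

definition young :: "'v \<Rightarrow> 'v \<Rightarrow> 'v \<Rightarrow> 'v \<Rightarrow> 'v \<Rightarrow> 'v"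
  where "young p q r = 2 *\<^sub>R wedge p q r - wedge q r p - wedge r p q"

lemma \<Omega>_wedge: "\<Omega> (wedge p q r X Y) Z = Im ((herm X p * herm Y q - herm X q * herm Y p) * herm Z r)"
proof -
  have "herm (wedge p q r X Y) Z = cnj ((herm X p * herm Y q - herm X q * herm Y p) * herm Z r)"
    by (simp add: wedge_def)
  then show ?thesis by (simp only: \<Omega>_eq_Im_herm complex_cnj minus_minus cnj.sel)
qed

lemma sum_fun_apply2: "(\<Sum>a\<in>A. f a) X Y = (\<Sum>a\<in>A. f a X Y)"
  by (induction A rule: infinite_finite_induct) auto

lemma \<Omega>_sum_left: "\<Omega> (sum f A) Y = (\<Sum>a\<in>A. \<Omega> (f a) Y)"
  by (induction A rule: infinite_finite_induct) auto

text \<open>Expanding both arguments of \<open>S\<close> in the frame recovers its trilinear form.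
  Symmetrizing multiplies it by 6: a factor 2 from antisymmetry in the first two slots, and a factor
  3 because the cyclic sum vanishes.\<close>

lemma \<N>_eq_sum_young:
  assumes B: "finite B" "\<And>X. X = (\<Sum>b\<in>B. herm X b \<odot> b)" and S: "S \<in> \<N> \<Omega> j"
  shows "S = (1/6) *\<^sub>R (\<Sum>a\<in>B. \<Sum>b\<in>B. young a b (S a b))"
proof -
  have exp: "(\<Sum>a\<in>B. \<Sum>b\<in>B. Im (herm X a * herm Y b * herm Z (S a b))) = \<Omega> (S X Y) Z" for X Y Z
  proof -
    have "S X Y = (\<Sum>a\<in>B. \<Sum>b\<in>B. cnj (herm X a * herm Y b) \<odot> S a b)"
      by (subst B(2)[of X], subst B(2)[of Y])
        (simp add: \<N>_sum[OF S] \<N>_simps[OF S] cx.scale_sum_right,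
          rule trans[OF sum.swap], intro sum.cong refl, simp add: mult.commute)
    then have "herm Z (S X Y) = (\<Sum>a\<in>B. \<Sum>b\<in>B. herm X a * herm Y b * herm Z (S a b))"
      by (simp add: herm_sum_right)
    moreover have "\<Omega> (S X Y) Z = Im (herm Z (S X Y))"
      using \<Omega>_alt[of Z "S X Y"] by (simp add: \<Omega>_eq_Im_herm)
    ultimately show ?thesis by (simp only: Im_sum)
  qed
  show ?thesis
  proof (intro ext \<Omega>_ext)
    fix X Y Z
    have young: "\<Omega> (young a b s X Y) Z =
      2 * (Im (herm X a * herm Y b * herm Z s) - Im (herm Y a * herm X b * herm Z s))
      - (Im (herm Z a * herm X b * herm Y s) - Im (herm Z a * herm Y b * herm X s))
      - (Im (herm Y a * herm Z b * herm X s) - Im (herm X a * herm Z b * herm Y s))" for a b s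
      unfolding young_def
      by (simp add: scaleR_fun_def \<Omega>_wedge) (simp add: algebra_simps)
    have "\<Omega> (((1/6) *\<^sub>R (\<Sum>a\<in>B. \<Sum>b\<in>B. young a b (S a b))) X Y) Z
        = (1/6) * (\<Sum>a\<in>B. \<Sum>b\<in>B. \<Omega> (young a b (S a b) X Y) Z)"
      by (simp add: scaleR_fun_def sum_fun_apply2 \<Omega>_sum_left)
    also have "(\<Sum>a\<in>B. \<Sum>b\<in>B. \<Omega> (young a b (S a b) X Y) Z) =
      2 * (\<Omega> (S X Y) Z - \<Omega> (S Y X) Z) - (\<Omega> (S Z X) Y - \<Omega> (S Z Y) X)
      - (\<Omega> (S Y Z) X - \<Omega> (S X Z) Y)"
      unfolding young sum_subtractf sum_distrib_left[symmetric] exp ..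
    also have "\<dots> = 6 * \<Omega> (S X Y) Z"
      using \<N>_cyclic[OF S, of X Y Z] \<N>_alt[OF S, of Y X] \<N>_alt[OF S, of Z Y] \<N>_alt[OF S, of X Z]
      by simp
    finally show "\<Omega> (S X Y) Z = \<Omega> (((1/6) *\<^sub>R (\<Sum>a\<in>B. \<Sum>b\<in>B. young a b (S a b))) X Y) Z" by simp
  qed
qed

section \<open>Weight components inside an invariant subspace\<close>

text \<open>The summands are the components of degree 0, 1 and 2 in the line of \<open>u\<close>; the one of degree 3 vanishes
  because \<open>T\<close> is alternating.\<close>

lemma crefl_weights:
  assumes T: "T \<in> \<N> \<Omega> j" and u: "herm u u = 1" and z: "z * cnj z = 1"
  defines "P \<equiv> \<lambda>X. herm X u \<odot> u"
  shows "tensor_action (crefl u (1 - z)) T X Y =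
    (T (X - P X) (Y - P Y) - P (T (X - P X) (Y - P Y)))
    + z \<odot> (P (T (X - P X) (Y - P Y)) + (T (P X) (Y - P Y) - P (T (P X) (Y - P Y)))
        + (T (X - P X) (P Y) - P (T (X - P X) (P Y))))
    + z\<^sup>2 \<odot> (P (T (P X) (Y - P Y)) + P (T (X - P X) (P Y)))"
proof -
  have uni: "(1 - z) + cnj (1 - z) = (1 - z) * cnj (1 - z) * herm u u"
    using z by (simp add: u algebra_simps)
  have c: "crefl u (1 - c) Z = (Z - P Z) + c \<odot> P Z" for c Z
    by (simp add: crefl_def P_def algebra_simps)
  have P: "P (A + B) = P A + P B" "P (c \<odot> A) = c \<odot> P A" for A B c
    by (simp_all add: P_def algebra_simps)
  have PP: "T (P X) (P Y) = 0" by (simp add: P_def \<N>_simps[OF T])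
  \<comment> \<open>The inverse rotation multiplies the line of \<open>u\<close> by
    \<open>cnj z\<close>, and antilinearity turns this back into \<open>z\<close>. Each argument
    along \<open>u\<close> thus contributes one factor \<open>z\<close>, and so does a value along
    \<open>u\<close>.\<close>
  have "T ((X - P X) + cnj z \<odot> P X) ((Y - P Y) + cnj z \<odot> P Y) =
    T (X - P X) (Y - P Y) + z \<odot> (T (P X) (Y - P Y) + T (X - P X) (P Y))"
    unfolding \<N>_simps(1,2,5,6)[OF T] PP by (simp add: cx.scale_right_distrib)
  then show ?thesis
    unfolding tensor_action_def inv_crefl[OF uni] complex_cnj_diff complex_cnj_one c
    by (simp add: P cx.scale_right_distrib cx.scale_right_diff_distrib power2_eq_square)
qed

context
  fixes W
  assumes W_sub: "W \<subseteq> \<N> \<Omega> j" and W_inv: "invariant_subspace (Sp \<Omega> \<inter> Gl j) tensor_action W"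
begin

lemma W_subspace: "subspace W"
  using W_inv by (simp add: invariant_subspace_def)

lemma W_action: "g \<in> Sp \<Omega> \<inter> Gl j \<Longrightarrow> T \<in> W \<Longrightarrow> tensor_action g T \<in> W"
  using W_inv unfolding invariant_subspace_def by blast

lemma W_cscale:
  assumes "S \<in> W"
  shows "(\<lambda>X Y. c \<odot> S X Y) \<in> W"
proof -
  have S: "S \<in> \<N> \<Omega> j" using assms W_sub by blast
  \<comment> \<open>Pulling the inverse of \<open>j\<close> out of both arguments gives
    \<open>-1\<close>, so only the outer \<open>j\<close> remains, with a sign.\<close>
  have "tensor_action j S X Y = - j (S X Y)" for X Y
    by (simp add: tensor_action_def inv_j \<N>_simps[OF S])
  then have "(\<lambda>X Y. c \<odot> S X Y) = Re c *\<^sub>R S - Im c *\<^sub>R tensor_action j S"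
    by (intro ext) (simp add: scaleR_fun_def cscale_def)
  then show ?thesis
    using W_subspace assms W_action[OF j_unitary assms]
    by (simp add: subspace_diff subspace_scale)
qed

text \<open>The rotated tensor is a quadratic polynomial in \<open>z\<close> whose values on the
  unit circle lie in \<open>W\<close>. Sampling at fourth roots of unity extracts the coefficients
  of degree 1 and 2.\<close>

lemma weight_components:
  assumes T: "T \<in> W" and u: "herm u u = 1"
  defines "P \<equiv> \<lambda>X. herm X u \<odot> u"
  shows "(\<lambda>X Y. P (T (X - P X) (Y - P Y)) + (T (P X) (Y - P Y) - P (T (P X) (Y - P Y)))
        + (T (X - P X) (P Y) - P (T (X - P X) (P Y)))) \<in> W" (is "?T1 \<in> W")
    and "(\<lambda>X Y. P (T (P X) (Y - P Y)) + P (T (X - P X) (P Y))) \<in> W" (is "?T2 \<in> W")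
proof -
  define g where "g z = tensor_action (crefl u (1 - z)) T" for z
  have gW: "g z \<in> W" if "z * cnj z = 1" for z
    unfolding g_def using that u
    by (intro W_action crefl_unitary T) (simp add: algebra_simps)
  have TN: "T \<in> \<N> \<Omega> j" using T W_sub by blast
  have g: "g z X Y = (T (X - P X) (Y - P Y) - P (T (X - P X) (Y - P Y))) + z \<odot> ?T1 X Y + z\<^sup>2 \<odot> ?T2 X Y" if "z * cnj z = 1" for z X Y
    unfolding g_def P_def by (rule crefl_weights[OF TN u that])
  have unit: "1 * cnj 1 = 1" "(- 1) * cnj (- 1) = 1" "\<i> * cnj \<i> = 1" "(- \<i>) * cnj (- \<i>) = 1"
    by simp_all
  have *: "b = (1/2) *\<^sub>R ((a + 1 \<odot> b + 1\<^sup>2 \<odot> c) - (a + (- 1) \<odot> b + (- 1)\<^sup>2 \<odot> c))" for a b c :: 'v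
    by (simp add: scaleR_2[symmetric])
  have "?T1 = (1/2) *\<^sub>R (g 1 - g (- 1))"
    by (intro ext, simp only: scaleR_fun_def minus_apply g[OF unit(1)] g[OF unit(2)], rule *)
  then show "?T1 \<in> W"
    using W_subspace gW[of 1] gW[of "- 1"] by (simp add: subspace_diff subspace_scale)
  \<comment> \<open>Since \<open>z^2\<close> is 1 at the real points and -1 at the imaginary ones,
    the alternating sum cancels \<open>a\<close> and \<open>b\<close> and counts \<open>c\<close>
    four times.\<close>
  have *: "c = (1/4) *\<^sub>R ((a + 1 \<odot> b + 1\<^sup>2 \<odot> c) + (a + (- 1) \<odot> b + (- 1)\<^sup>2 \<odot> c)
      - (a + \<i> \<odot> b + \<i>\<^sup>2 \<odot> c) - (a + (- \<i>) \<odot> b + (- \<i>)\<^sup>2 \<odot> c))" for a b c :: 'v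
    by (simp add: cscale_def algebra_simps flip: scaleR_left_distrib)
  have "?T2 = (1/4) *\<^sub>R (g 1 + g (- 1) - g \<i> - g (- \<i>))"
    by (intro ext, simp only: scaleR_fun_def plus_fun_apply minus_apply
        g[OF unit(1)] g[OF unit(2)] g[OF unit(3)] g[OF unit(4)], rule *)
  then show "?T2 \<in> W"
    using W_subspace gW[of 1] gW[of "- 1"] gW[of \<i>] gW[of "- \<i>"]
    by (simp add: subspace_diff subspace_scale subspace_add)
qed

lemma wedge_component_mem:
  assumes T: "T \<in> W" and u: "herm u u = 1" and v: "herm v v = 1"
    and uv: "herm u v = 0" "herm v u = 0"
  shows "wedge u v (herm (T u v) u \<odot> u) \<in> W"
proof -
  have TN: "T \<in> \<N> \<Omega> j" using T W_sub by blast
  \<comment> \<open>The component of degree 2 in \<open>u\<close>, simplified by the vanishing of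
    \<open>T\<close> when both arguments lie along \<open>u\<close>.\<close>
  define S where "S X Y = (cnj (herm X u) * herm (T u Y) u + cnj (herm Y u) * herm (T X u) u) \<odot> u"
    for X Y
  have "S \<in> W"
  proof -
    have "S = (\<lambda>X Y. herm (T (herm X u \<odot> u) (Y - herm Y u \<odot> u)) u \<odot> u
        + herm (T (X - herm X u \<odot> u) (herm Y u \<odot> u)) u \<odot> u)"
      by (intro ext) (simp add: S_def \<N>_simps[OF TN] cx.scale_left_distrib)
    then show ?thesis using weight_components(2)[OF T u] by simp
  qed
  \<comment> \<open>The component of \<open>S\<close> of degree 1 in \<open>v\<close>. Values of
    \<open>S\<close> are orthogonal to \<open>v\<close>, so only terms with exactly one argument
    along \<open>v\<close> remain, and antisymmetry of \<open>T\<close> combines them into a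
    wedge.\<close>
  have "wedge u v (herm (T u v) u \<odot> u) = (\<lambda>X Y. herm (S (X - herm X v \<odot> v) (Y - herm Y v \<odot> v)) v \<odot> v
      + (S (herm X v \<odot> v) (Y - herm Y v \<odot> v) - herm (S (herm X v \<odot> v) (Y - herm Y v \<odot> v)) v \<odot> v)
      + (S (X - herm X v \<odot> v) (herm Y v \<odot> v) - herm (S (X - herm X v \<odot> v) (herm Y v \<odot> v)) v \<odot> v))"
    using \<N>_alt[OF TN, of v u]
    by (intro ext) (simp add: S_def wedge_def \<N>_simps[OF TN] uv algebra_simps)
  then show ?thesis using weight_components(1)[OF \<open>S \<in> W\<close> v] by simp
qed

end

section \<open>Moving orthonormal pairs\<close>

text \<open>Fixing the vectors orthogonal to \<open>p\<close> and \<open>q\<close> allows one member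
  of an orthonormal pair to be moved while the other stays.\<close>

lemma ex_crefl_map:
  assumes p: "herm p p = 1" and q: "herm q q = 1"
  obtains w c where "c + cnj c = c * cnj c * herm w w" "crefl w c p = q"
    "\<And>r. herm r p = 0 \<Longrightarrow> herm r q = 0 \<Longrightarrow> crefl w c r = r"
proof (cases "p = q")
  case True
  show thesis by (rule that[of 0 0]) (simp_all add: crefl_def True)
next
  case False
  define w where "w = p - q"
  \<comment> \<open>With coefficient \<open>inverse a\<close>, the reflection subtracts exactly
    \<open>w\<close> from \<open>p\<close>. As \<open>p\<close> and \<open>q\<close> have equal
    length, \<open>a + cnj a\<close> is the squared length of \<open>w\<close>, which gives
    unitarity and \<open>a \<noteq> 0\<close>.\<close>
  define a where "a = herm p w"
  have a: "a + cnj a = herm w w"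
    by (simp add: a_def w_def p q)
  have "a \<noteq> 0"
  proof
    assume "a = 0"
    then have "w = 0" using a by simp
    then show False using False by (simp add: w_def)
  qed
  show thesis
  proof (rule that[of "inverse a" w])
    show "inverse a + cnj (inverse a) = inverse a * cnj (inverse a) * herm w w"
      unfolding a[symmetric] using \<open>a \<noteq> 0\<close> by (simp add: field_simps del: cnj_herm)
    show "crefl w (inverse a) p = q"
      using \<open>a \<noteq> 0\<close> by (simp add: crefl_def flip: a_def) (simp add: w_def)
    show "crefl w (inverse a) r = r" if "herm r p = 0" "herm r q = 0" for r
      using that by (simp add: crefl_def w_def)
  qed
qed

text \<open>The Hermitian adjoint of the reflection is its inverse, so the inverses on the arguments
  pass to \<open>p\<close> and \<open>q\<close>.\<close>

lemma tensor_action_crefl_wedge: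
  assumes "c + cnj c = c * cnj c * herm w w"
  shows "tensor_action (crefl w c) (wedge p q r) = wedge (crefl w c p) (crefl w c q) (crefl w c r)"
proof -
  have "herm (crefl w (cnj c) X) p = herm X (crefl w c p)" for X p
    by (simp add: crefl_def)
  then show ?thesis
    by (intro ext) (simp add: tensor_action_def inv_crefl[OF assms] wedge_def,
        simp add: crefl_def algebra_simps)
qed

lemma orthonormal_pair:
  assumes "u \<noteq> 0"
  obtains a x m b y where "herm x x = 1" "u = a \<odot> x" "v = m \<odot> x + b \<odot> y"
    "b = 0 \<or> herm y y = 1 \<and> herm x y = 0 \<and> herm y x = 0"
proof -
  obtain a x where x: "herm x x = 1" "u = a \<odot> x" by (rule normalize[OF assms])
  define r where "r = v - herm v x \<odot> x"
  have rx: "herm r x = 0" by (simp add: r_def x)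
  show thesis
  proof (cases "r = 0")
    case True
    \<comment> \<open>In the dependent case the second vector is a placeholder: \<open>b = 0\<close>
      imposes nothing on it.\<close>
    then have "v = herm v x \<odot> x + 0 \<odot> 0" by (simp add: r_def)
    then show thesis using that x by blast
  next
    case False
    obtain b y where y: "herm y y = 1" "r = b \<odot> y" "b \<noteq> 0" by (rule normalize[OF False])
    have yx: "herm y x = 0" using rx y(2,3) by simp
    then have "herm x y = 0" using cnj_herm[of y x] by (simp del: cnj_herm)
    moreover have "v = herm v x \<odot> x + b \<odot> y" unfolding y(2)[symmetric] by (simp add: r_def)
    ultimately show thesis using that x y(1) yx by blast
  qed
qed

text \<open>If every such coefficient vanished, dropping the part of \<open>v\<close> along
  \<open>u\<close> would give \<open>herm (T u v) u = 0\<close> for all vectors, and polarization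
  with the zero subspace would force \<open>T = 0\<close>.\<close>

lemma ex_nonzero_coefficient:
  assumes T: "T \<in> \<N> \<Omega> j" and "T \<noteq> 0"
  obtains (witness) u v where "herm u u = 1" "herm v v = 1" "herm u v = 0" "herm v u = 0"
    "herm (T u v) u \<noteq> 0"
proof (rule ccontr)
  assume contra: "\<not> thesis"
  have zero: "herm (T u v) u = 0"
    if "herm u u = 1" "herm v v = 1" "herm u v = 0" "herm v u = 0" for u v
    using that contra witness by blast
  have "herm (T u v) u = 0" for u v
  proof (cases "u = 0")
    case False
    obtain a x m b y where *: "herm x x = 1" "u = a \<odot> x" "v = m \<odot> x + b \<odot> y"
      "b = 0 \<or> herm y y = 1 \<and> herm x y = 0 \<and> herm y x = 0"
      by (rule orthonormal_pair[OF False])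
    have "cnj b * herm (T x y) x = 0" using *(4) zero[OF *(1)] by auto
    then show ?thesis unfolding *(2,3) by (auto simp: \<N>_simps[OF T])
  qed simp
  then have diag: "\<Omega> (T u v) u \<in> {0}" for u v by (simp add: \<Omega>_eq_Im_herm)
  have alt: "\<Omega> (T x y) z = - \<Omega> (T y x) z" for x y z
    using \<N>_alt[OF T, of x y] by simp
  have "\<Omega> (T x y) z \<in> {0}" for x y z
    by (rule mem_of_polarization[where f = "\<lambda>x y z. \<Omega> (T x y) z", OF _ _ _ alt \<N>_cyclic[OF T] diag])
      (simp_all add: \<N>_simps[OF T] subspace_single_0)
  then have "T x y = 0" for x y by (intro \<Omega>_ext) simp
  then have "T = 0" by (intro ext) simp
  then show False using \<open>T \<noteq> 0\<close> by simp
qed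

section \<open>Generating all Young tensors from one nonzero tensor\<close>

lemma wedge_simps:
  "wedge (p + p') q r = wedge p q r + wedge p' q r"
  "wedge p (q + q') r = wedge p q r + wedge p q' r"
  "wedge p q (r + r') = wedge p q r + wedge p q r'"
  "wedge (c \<odot> p) q r = (\<lambda>X Y. c \<odot> wedge p q r X Y)"
  "wedge p (c \<odot> q) r = (\<lambda>X Y. c \<odot> wedge p q r X Y)"
  "wedge p q (c \<odot> r) = (\<lambda>X Y. c \<odot> wedge p q r X Y)"
  "wedge p p r = 0"
  by (auto simp: fun_eq_iff wedge_def algebra_simps)

lemma wedge_alt: "wedge p q r = - wedge q p r"
  by (auto simp: fun_eq_iff wedge_def algebra_simps)

lemma young_mem:
  assumes W: "W \<subseteq> \<N> \<Omega> j" "invariant_subspace (Sp \<Omega> \<inter> Gl j) tensor_action W"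
    and "T \<in> W" "T \<noteq> 0"
  shows "young p q r \<in> W"
proof -
  have sub: "subspace W" using W(2) by (simp add: invariant_subspace_def)
  have "T \<in> \<N> \<Omega> j" using assms by blast
  then obtain u v where uv: "herm u u = 1" "herm v v = 1" "herm u v = 0" "herm v u = 0"
    and nz: "herm (T u v) u \<noteq> 0"
    using ex_nonzero_coefficient \<open>T \<noteq> 0\<close> by metis
  have "(\<lambda>X Y. inverse (herm (T u v) u) \<odot> wedge u v (herm (T u v) u \<odot> u) X Y) \<in> W"
    using W_cscale[OF W wedge_component_mem[OF W \<open>T \<in> W\<close> uv]] .
  then have base: "wedge u v u \<in> W" using nz by (simp add: wedge_simps)
  have ortho: "wedge x y x \<in> W"
    if xy: "herm x x = 1" "herm y y = 1" "herm x y = 0" "herm y x = 0" for x y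
  proof -
    \<comment> \<open>One reflection takes \<open>u\<close> to \<open>x\<close>. A second takes the
      image of \<open>v\<close> to \<open>y\<close> and fixes \<open>x\<close>, which is orthogonal
      to both.\<close>
    obtain w c where g: "c + cnj c = c * cnj c * herm w w" "crefl w c u = x"
      using ex_crefl_map[OF uv(1) xy(1)] by metis
    define v' where "v' = crefl w c v"
    have 1: "wedge x v' x \<in> W"
      using W_action[OF W crefl_unitary[OF g(1)] base]
      by (simp add: tensor_action_crefl_wedge[OF g(1)] g(2) v'_def)
    have v': "herm v' v' = 1" "herm x v' = 0"
      using herm_crefl[OF g(1), of v v] herm_crefl[OF g(1), of u v] uv by (simp_all add: v'_def g(2))
    obtain w' c' where h: "c' + cnj c' = c' * cnj c' * herm w' w'" "crefl w' c' v' = y"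
      "\<And>r. herm r v' = 0 \<Longrightarrow> herm r y = 0 \<Longrightarrow> crefl w' c' r = r"
      using ex_crefl_map[OF v'(1) xy(2)] by metis
    show ?thesis
      using W_action[OF W crefl_unitary[OF h(1)] 1]
      by (simp add: tensor_action_crefl_wedge[OF h(1)] h(2) h(3)[OF v'(2) xy(3)])
  qed
  have diag: "wedge x y x \<in> W" for x y
  proof (cases "x = 0")
    case True
    have "wedge x y x = 0" by (simp add: True wedge_def fun_eq_iff)
    then show ?thesis using sub by (simp add: subspace_0)
  next
    case False
    obtain a e m b f where *: "herm e e = 1" "x = a \<odot> e" "y = m \<odot> e + b \<odot> f"
      "b = 0 \<or> herm f f = 1 \<and> herm e f = 0 \<and> herm f e = 0"
      by (rule orthonormal_pair[OF False])
    \<comment> \<open>The part of \<open>y\<close> along \<open>e\<close> drops out of the wedge,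
      and the scalars come out without conjugation.\<close>
    have eq: "wedge x y x = (\<lambda>X Y. (a * a * b) \<odot> wedge e f e X Y)"
      unfolding *(2,3) by (simp add: wedge_simps fun_eq_iff ac_simps)
    show ?thesis
    proof (cases "b = 0")
      case True
      then have "wedge x y x = 0" unfolding eq by (simp add: fun_eq_iff)
      then show ?thesis using sub by (simp add: subspace_0)
    next
      case False
      then show ?thesis unfolding eq using *(1,4) by (intro W_cscale[OF W] ortho) auto
    qed
  qed
  show ?thesis
  \<comment> \<open>Polarization applies to \<open>young\<close>, which satisfies the cyclic
    identity by construction; on the diagonal it is three times the wedge already placed in
    \<open>W\<close>.\<close>
  proof (rule mem_of_polarization[OF sub])
    show "young x y x \<in> W" for x y
    proof -
      have "young x y x = 3 *\<^sub>R wedge x y x"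
        using wedge_alt[of y x x] scaleR_left_distrib[of 2 1 "wedge x y x"]
        by (simp add: young_def wedge_simps(7))
      then show ?thesis using sub diag by (simp add: subspace_scale)
    qed
    show "young x y z = - young y x z" for x y z
      using wedge_alt[of x y z] wedge_alt[of y z x] wedge_alt[of z x y] by (simp add: young_def)
    show "young x y z + young y z x + young z x y = 0" for x y z
      by (simp add: young_def scaleR_2)
  qed (simp_all add: young_def wedge_simps scaleR_right_distrib fun_eq_iff)
qed

lemma irreducible:
  assumes "finite A" "span A = (UNIV :: 'v set)"
  shows "irreducible_under (Sp \<Omega> \<inter> Gl j) tensor_action (\<N> \<Omega> j)"
  unfolding irreducible_under_def
proof (intro conjI allI impI \<N>_invariant)
  fix W assume "W \<subseteq> \<N> \<Omega> j \<and> invariant_subspace (Sp \<Omega> \<inter> Gl j) tensor_action W"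
  then have W: "W \<subseteq> \<N> \<Omega> j" "invariant_subspace (Sp \<Omega> \<inter> Gl j) tensor_action W" by auto
  then have sub: "subspace W" by (simp add: invariant_subspace_def)
  obtain B where B: "finite B" "\<And>X. X = (\<Sum>b\<in>B. herm X b \<odot> b)"
    using ex_frame[OF assms] by blast
  show "W = {0} \<or> W = \<N> \<Omega> j"
  proof (cases "W \<subseteq> {0}")
    case True
    then show ?thesis using subspace_0[OF sub] by blast
  next
    case False
    then obtain T where T: "T \<in> W" "T \<noteq> 0" by blast
    have "S \<in> W" if "S \<in> \<N> \<Omega> j" for S
      by (subst \<N>_eq_sum_young[OF B that])
        (intro subspace_scale subspace_sum sub young_mem[OF W T])
    then show ?thesis using W(1) by blast
  qed
qed

end

theorem theorem1p1:
  fixes \<Omega> :: "'v::real_vector \<Rightarrow> 'v \<Rightarrow> real" and j :: "'v \<Rightarrow> 'v" and n :: nat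
  assumes "\<exists>B::'v set. finite B \<and> span B = UNIV"
    and "dim (UNIV :: 'v set) = 2 * n"
    and "symplectic_form \<Omega>"
    and "positive_compatible_complex_structure \<Omega> j"
  shows "irreducible_under (Sp \<Omega> \<inter> Gl j) tensor_action (\<N> \<Omega> j)"
proof -
  interpret hermitian_space \<Omega> j
    by (rule hermitian_space.intro) (fact assms)+
  show ?thesis using assms(1) irreducible by blast
qed

end
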